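(* Let $n\in\mathbb{N}$, $n\ge 1$. Let $\mathcal{T}$ be a positive linear functional defined (at least) on the linear subspace of $\mathbb{R}^{[-1,1]}$ generated by the cone of all $(2n-1)$-convex functions $[-1,1]\to\mathbb{R}$. Assume that $\mathcal{T}$ is exact on $\Pi_{2n-1}$. If a function $f:[-1,1]\to\mathbb{R}$ is $(2n-1)$-convex, then $$\mathcal{G}_n(f)\le\mathcal{T}(f)\le\mathcal{L}_{n+1}(f).$$
   Context: Divided differences: $[x_1;f]:=f(x_1)$ and $[x_1,\dots,x_{k+1};f]:=\frac{[x_2,\dots,x_{k+1};f]-[x_1,\dots,x_k;f]}{x_{k+1}-x_1}$ for $k\ge 1$. For an integer $m\ge 1$, a function $f:I\to\mathbb{R}$ on an interval $I$ is $m$-convex if $[x_1,\dots,x_{m+2};f]\ge 0$ for all distinct $x_1,\dots,x_{m+2}\in I$ (so $1$-convexity is ordinary convexity; no differentiability or continuity is assumed). $\Pi_m$ is the space of real polynomials of degree at most $m$. $\mathcal{I}(f):=\int_{-1}^1 f(x)\,dx$. A real-valued linear functional $\mathcal{T}$ on a linear space $X$ of real functions is positive if $f\le g$ (pointwise) implies $\mathcal{T}(f)\le\mathcal{T}(g)$ for all $f,g\in X$. $\mathcal{T}$ is exact on $\Pi_m$ if $\mathcal{T}(p)=\mathcal{I}(p)$ for all $p\in\Pi_m$. $P_m$ is the Legendre polynomial of degree $m$ (standard normalization $P_m(1)=1$). For $f:[-1,1]\to\mathbb{R}$: Gauss–Legendre: for $m\ge 1$, $\mathcal{G}_m(f):=\sum_{i=1}^m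 w_i f(x_i)$, where $x_1,\dots,x_m$ are the roots of $P_m$ and $w_i=\frac{2(1-x_i^2)}{(m+1)^2P_{m+1}^2(x_i)}$. Lobatto: $\mathcal{L}_2(f):=f(-1)+f(1)$, and for $m\ge 3$, $\mathcal{L}_m(f):=w_1f(-1)+w_mf(1)+\sum_{i=2}^{m-1}w_if(x_i)$, where $x_2,\dots,x_{m-1}$ are the roots of $P_{m-1}'$, $w_1=w_m=\frac{2}{m(m-1)}$ and $w_i=\frac{2}{m(m-1)P_{m-1}^2(x_i)}$ for $2\le i\le m-1$. *)

theory Defs
  imports
    "HOL-Analysis.Analysis"
    "HOL-Computational_Algebra.Polynomial"
    "HOL-Library.Function_Algebras"
begin

(* The value on the empty list is irrelevant. *)
fun divided_difference :: "(real \<Rightarrow> real) \<Rightarrow> real list \<Rightarrow> real" where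
  "divided_difference f [] = 0"
| "divided_difference f [x] = f x"
| "divided_difference f (x # y # zs) =
     (divided_difference f (y # zs) - divided_difference f (butlast (x # y # zs)))
       / (last (y # zs) - x)"

definition m_convex_on :: "nat \<Rightarrow> real set \<Rightarrow> (real \<Rightarrow> real) \<Rightarrow> bool" where
  "m_convex_on m I f \<longleftrightarrow>
     (\<forall>xs. length xs = m + 2 \<and> distinct xs \<and> set xs \<subseteq> I \<longrightarrow> divided_difference f xs \<ge> 0)"

(* Rodrigues' formula *)
definition legendre :: "nat \<Rightarrow> real poly" where
  "legendre m = smult (1 / (2 ^ m * fact m)) ((pderiv ^^ m) ([:-1, 0, 1:] ^ m))"

lemma poly_legendre_1: "poly (legendre m) 1 = 1"
proof -
  have aux: "poly ((pderiv ^^ k) ([:-1, 1:] ^ k * q)) 1 = fact k * poly q 1"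
    for k and q :: "real poly"
  proof (induction k arbitrary: q)
    case (Suc k)
    have "pderiv ([:-1, 1:] ^ Suc k * q) =
            [:-1, 1:] ^ k * (smult (real (Suc k)) q + [:-1, 1:] * pderiv q)"
      by (simp only: pderiv_mult pderiv_power_Suc) (simp add: pderiv_pCons algebra_simps)
    then show ?case
      by (simp add: funpow_Suc_right Suc.IH del: funpow.simps power_Suc)
  qed simp
  have "[:-1, 0, 1:] = [:-1, 1:] * ([:1, 1:] :: real poly)"
    by simp
  then have "poly ((pderiv ^^ m) ([:-1, 0, 1:] ^ m)) (1 :: real) = fact m * 2 ^ m"
    by (simp add: power_mult_distrib aux poly_power del: mult_pCons_left mult_pCons_right)
  then show ?thesis
    by (simp add: legendre_def)
qed

(* All complex roots of the m-th Legendre polynomial are real and simple, so summing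
   over the set of real roots is summing over x_1, ..., x_m; similarly for its derivative. *)
definition gauss_legendre :: "nat \<Rightarrow> (real \<Rightarrow> real) \<Rightarrow> real" where
  "gauss_legendre m f =
     (\<Sum>x | poly (legendre m) x = 0.
        2 * (1 - x\<^sup>2) / ((real m + 1)\<^sup>2 * (poly (legendre (m + 1)) x)\<^sup>2) * f x)"

(* Meaningful for m \<ge> 2 only. *)
definition lobatto :: "nat \<Rightarrow> (real \<Rightarrow> real) \<Rightarrow> real" where
  "lobatto m f =
     (if m = 2 then f (-1) + f 1
      else 2 / (real m * (real m - 1)) * f (-1) + 2 / (real m * (real m - 1)) * f 1
        + (\<Sum>x | poly (pderiv (legendre (m - 1))) x = 0.
             2 / (real m * (real m - 1) * (poly (legendre (m - 1)) x)\<^sup>2) * f x))"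

(* Real functions as a vector space; provides fun_space.subspace and fun_space.span. *)
global_interpretation fun_space: vector_space "\<lambda>(c::real) (f::real \<Rightarrow> real) x. c * f x"
  by unfold_locales (auto simp: fun_eq_iff algebra_simps)

definition linear_functional_on ::
    "(real \<Rightarrow> real) set \<Rightarrow> ((real \<Rightarrow> real) \<Rightarrow> real) \<Rightarrow> bool" where
  "linear_functional_on X T \<longleftrightarrow>
     (\<forall>f\<in>X. \<forall>g\<in>X. T (\<lambda>x. f x + g x) = T f + T g) \<and>
     (\<forall>c. \<forall>f\<in>X. T (\<lambda>x. c * f x) = c * T f)"

(* Functions on I are represented by total functions, whose values outside I are to be
   ignored. Positivity compares on I only; for T linear on X it therefore implies that T
   takes the same value on any two members of X that agree on I, i.e. that T is a
   functional on the space of restrictions of members of X to I. *)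
definition positive_functional_on ::
    "real set \<Rightarrow> (real \<Rightarrow> real) set \<Rightarrow> ((real \<Rightarrow> real) \<Rightarrow> real) \<Rightarrow> bool" where
  "positive_functional_on I X T \<longleftrightarrow>
     (\<forall>f\<in>X. \<forall>g\<in>X. (\<forall>x\<in>I. f x \<le> g x) \<longrightarrow> T f \<le> T g)"

definition exact_on_degree :: "nat \<Rightarrow> ((real \<Rightarrow> real) \<Rightarrow> real) \<Rightarrow> bool" where
  "exact_on_degree m T \<longleftrightarrow>
     (\<forall>p :: real poly. degree p \<le> m \<longrightarrow> T (poly p) = integral {-1..1} (poly p))"

end

theory Submission
  imports Defs
begin

text \<open>
  Both bounds come from one principle. A \<open>(2n-1)\<close>-convex function behaves as if its derivative of
  order \<open>2n\<close> were nonnegative. Interpolate it by a polynomial \<open>p\<close> of degree at most \<open>2n-1\<close>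
  at \<open>2n\<close> nodes: the error \<open>f - p\<close> is a nonnegative divided difference times the node
  polynomial (\<open>interpolation_remainder\<close>). If all nodes are double, then \<open>p \<le> f\<close>; if the two
  endpoints are simple nodes and all others are double, then \<open>f \<le> p\<close> on \<open>[-1, 1]\<close>. Take as
  nodes those of a quadrature rule that is exact in degree \<open>2n-1\<close>. Positivity compares \<open>T f\<close>
  with \<open>T p\<close>, exactness turns \<open>T p\<close> into the integral of \<open>p\<close> and then into the value of the
  rule at \<open>p\<close>, and the rule does not distinguish \<open>p\<close> from \<open>f\<close>. The Gauss rule gives the
  lower bound, the Lobatto rule the upper one.

  Double nodes would require derivatives. They are replaced by pairs of nodes at distance \<open>h\<close>,
  which spoils the sign of the error only between the two nodes of a pair, and there only by
  \<open>O(h)\<close>, because divided differences of order \<open>2n-1\<close> are monotone in each node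
  (\<open>ddiff_mono\<close>) and therefore bounded (\<open>ddiff_bounded\<close>). The outcome is
  \<open>definite_interpolant\<close>, from which \<open>definite_quadrature\<close> derives the comparison of a
  positive functional with a quadrature rule.

  The other half is classical: with the explicit weights, both rules are exact in degree \<open>2n-1\<close>
  (\<open>gauss_legendre_exact\<close>, \<open>lobatto_exact\<close>). Rodrigues' formula yields orthogonality, the
  recurrence and the differential equation, and by Rolle's theorem it yields the location and
  simplicity of the nodes. Exactness of the interpolatory rules is then Gauss's division argument.
  Their weights are found without the Christoffel-Darboux formula: the exact rule is applied to
  well-chosen polynomials whose integrals are known up to boundary terms.
\<close>

section \<open>Divided differences over finite sets\<close>

text \<open>
  The explicit symmetric form of the divided difference. Indexing by a set makes independence
  of the order of the nodes automatic, so nodes can be exchanged freely. Double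
  nodes will be approximated by pairs of close distinct ones.
\<close>
definition ddiff :: "(real \<Rightarrow> real) \<Rightarrow> real set \<Rightarrow> real" where
  "ddiff f S = (\<Sum>x\<in>S. f x / (\<Prod>y\<in>S - {x}. x - y))"

lemma ddiff_insert:
  assumes "finite S" "a \<notin> S"
  shows "ddiff f (insert a S) =
    f a / (\<Prod>y\<in>S. a - y) + (\<Sum>x\<in>S. f x / ((x - a) * (\<Prod>y\<in>S - {x}. x - y)))"
proof -
  have "(\<Prod>y\<in>insert a S - {x}. x - y) = (x - a) * (\<Prod>y\<in>S - {x}. x - y)" if "x \<in> S" for x
  proof -
    have "insert a S - {x} = insert a (S - {x})"
      using assms that by auto
    then show ?thesis
      using assms by simp
  qed
  moreover have "insert a S - {a} = S"
    using assms by auto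
  ultimately show ?thesis
    using assms by (simp add: ddiff_def)
qed

lemma partial_fractions:
  fixes A B P c :: real
  assumes "A \<noteq> 0" "B \<noteq> 0" "A \<noteq> B"
  shows "c / (A * (B * P)) = (c / (B * P) - c / (A * P)) / (A - B)"
proof (cases "P = 0")
  case False
  then have "c / (B * P) - c / (A * P) = (A - B) * (c / (A * (B * P)))"
    using assms by (simp add: divide_simps) (simp add: algebra_simps)
  then show ?thesis
    using assms by simp
qed simp

text \<open>
  Stated as a product, so that it reads directly as: exchanging the node \<open>a\<close> for a larger
  node \<open>b\<close> changes a divided difference by a positive multiple of one of the next order.
\<close>
lemma ddiff_recurrence:
  assumes "finite S" "a \<notin> S" "b \<notin> S" "a \<noteq> b"
  shows "(b - a) * ddiff f (insert a (insert b S)) = ddiff f (insert b S) - ddiff f (insert a S)"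
proof -
  let ?p = "\<lambda>x. \<Prod>y\<in>S - {x}. x - y"
  have b: "(\<Prod>y\<in>insert b S - {x}. x - y) = (x - b) * ?p x" if "x \<in> S" for x
  proof -
    have "insert b S - {x} = insert b (S - {x})"
      using assms that by auto
    then show ?thesis
      using assms by simp
  qed
  have b': "insert b S - {b} = S"
    using assms by auto
  have "ddiff f (insert a (insert b S)) = f a / ((a - b) * (\<Prod>y\<in>S. a - y)) +
      (f b / ((b - a) * (\<Prod>y\<in>S. b - y)) + (\<Sum>x\<in>S. f x / ((x - a) * ((x - b) * ?p x))))"
    using assms b b' by (subst ddiff_insert) auto
  also have "(\<Sum>x\<in>S. f x / ((x - a) * ((x - b) * ?p x))) =
      (\<Sum>x\<in>S. (f x / ((x - b) * ?p x) - f x / ((x - a) * ?p x)) / (b - a))"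
  proof (intro sum.cong refl)
    fix x assume x: "x \<in> S"
    then have "x - a \<noteq> 0" "x - b \<noteq> 0" "x - a \<noteq> x - b"
      using assms by auto
    from partial_fractions[OF this, of "f x" "?p x"] show "f x / ((x - a) * ((x - b) * ?p x)) =
        (f x / ((x - b) * ?p x) - f x / ((x - a) * ?p x)) / (b - a)"
      by simp
  qed
  also have "\<dots> = ((\<Sum>x\<in>S. f x / ((x - b) * ?p x)) - (\<Sum>x\<in>S. f x / ((x - a) * ?p x))) / (b - a)"
    by (simp only: sum_divide_distrib[symmetric] sum_subtractf)
  finally have e: "ddiff f (insert a (insert b S)) = f a / ((a - b) * (\<Prod>y\<in>S. a - y)) +
      (f b / ((b - a) * (\<Prod>y\<in>S. b - y)) +
       ((\<Sum>x\<in>S. f x / ((x - b) * ?p x)) - (\<Sum>x\<in>S. f x / ((x - a) * ?p x))) / (b - a))" .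
  have "f a / ((a - b) * (\<Prod>y\<in>S. a - y)) = - (f a / (\<Prod>y\<in>S. a - y)) / (b - a)"
    by (metis divide_divide_eq_left minus_diff_eq minus_divide_divide minus_divide_right mult.commute)
  moreover have "f b / ((b - a) * (\<Prod>y\<in>S. b - y)) = f b / (\<Prod>y\<in>S. b - y) / (b - a)"
    by (simp add: mult.commute)
  ultimately have "ddiff f (insert a (insert b S)) = (- (f a / (\<Prod>y\<in>S. a - y)) +
      (f b / (\<Prod>y\<in>S. b - y) +
       ((\<Sum>x\<in>S. f x / ((x - b) * ?p x)) - (\<Sum>x\<in>S. f x / ((x - a) * ?p x))))) / (b - a)"
    unfolding e by (simp only: add_divide_distrib)
  moreover have "b - a \<noteq> 0"
    using assms by simp
  ultimately have "(b - a) * ddiff f (insert a (insert b S)) = - (f a / (\<Prod>y\<in>S. a - y)) +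
      (f b / (\<Prod>y\<in>S. b - y) +
       ((\<Sum>x\<in>S. f x / ((x - b) * ?p x)) - (\<Sum>x\<in>S. f x / ((x - a) * ?p x))))"
    by simp
  then show ?thesis
    using assms by (simp add: ddiff_insert)
qed

text \<open>
  The recursive definition removes the first and the last node, which is
  \<open>ddiff_recurrence\<close> for this particular pair.
\<close>
lemma divided_difference_eq_ddiff:
  assumes "distinct xs" "xs \<noteq> []"
  shows "divided_difference f xs = ddiff f (set xs)"
  using assms
proof (induction f xs rule: divided_difference.induct)
  case (3 f x y zs)
  obtain ys b where yb: "y # zs = ys @ [b]"
    by (metis list.discI rev_exhaust)
  have d: "distinct (x # ys @ [b])"
    using "3.prems" yb by simp
  have i1: "divided_difference f (y # zs) = ddiff f (set (y # zs))"
    using "3.IH"(1) "3.prems" by simp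
  have i2: "divided_difference f (butlast (x # y # zs)) = ddiff f (set (butlast (x # y # zs)))"
    using "3.IH"(2) distinct_butlast[OF "3.prems"(1)] by simp
  have "divided_difference f (x # y # zs) =
      (ddiff f (set (y # zs)) - ddiff f (set (butlast (x # y # zs)))) / (last (y # zs) - x)"
    using i1 i2 by simp
  also have "\<dots> = (ddiff f (insert b (set ys)) - ddiff f (insert x (set ys))) / (b - x)"
    unfolding yb by (simp add: butlast_append)
  also have "\<dots> = ddiff f (insert x (insert b (set ys)))"
  proof -
    have "b - x \<noteq> 0"
      using d by auto
    then show ?thesis
      using ddiff_recurrence[of "set ys" x b f] d by (simp add: field_simps)
  qed
  also have "insert x (insert b (set ys)) = set (x # y # zs)"
    unfolding yb[symmetric] by (metis yb list.simps(15) rotate1.simps(2) set_rotate1)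
  finally show ?case .
qed (simp_all add: ddiff_def)

lemma m_convex_on_ddiff:
  "m_convex_on m I f \<longleftrightarrow> (\<forall>S. finite S \<and> card S = m + 2 \<and> S \<subseteq> I \<longrightarrow> 0 \<le> ddiff f S)"
proof
  assume m: "m_convex_on m I f"
  show "\<forall>S. finite S \<and> card S = m + 2 \<and> S \<subseteq> I \<longrightarrow> 0 \<le> ddiff f S"
  proof (intro allI impI)
    fix S assume S: "finite S \<and> card S = m + 2 \<and> S \<subseteq> I"
    then obtain xs where xs: "set xs = S" "distinct xs"
      using finite_distinct_list by blast
    then have "length xs = m + 2" "xs \<noteq> []"
      using S distinct_card[of xs] by auto
    then show "0 \<le> ddiff f S"
      using m xs S divided_difference_eq_ddiff[of xs f] by (auto simp: m_convex_on_def)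
  qed
next
  assume r: "\<forall>S. finite S \<and> card S = m + 2 \<and> S \<subseteq> I \<longrightarrow> 0 \<le> ddiff f S"
  show "m_convex_on m I f"
    unfolding m_convex_on_def
  proof (intro allI impI)
    fix xs assume xs: "length xs = m + 2 \<and> distinct xs \<and> set xs \<subseteq> I"
    then have "xs \<noteq> []"
      by auto
    with xs show "divided_difference f xs \<ge> 0"
      using r by (simp add: divided_difference_eq_ddiff distinct_card)
  qed
qed

section \<open>Lagrange interpolation and its remainder\<close>

definition lagrange_basis :: "real set \<Rightarrow> real \<Rightarrow> real poly" where
  "lagrange_basis S t = smult (1 / (\<Prod>y\<in>S - {t}. t - y)) (\<Prod>y\<in>S - {t}. [:- y, 1:])"

definition interpolant :: "(real \<Rightarrow> real) \<Rightarrow> real set \<Rightarrow> real poly" where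
  "interpolant f S = (\<Sum>t\<in>S. smult (f t) (lagrange_basis S t))"

lemma poly_lagrange_basis:
  "poly (lagrange_basis S t) x = (\<Prod>y\<in>S - {t}. x - y) / (\<Prod>y\<in>S - {t}. t - y)"
  by (simp add: lagrange_basis_def poly_prod)

lemma poly_lagrange_basis_node:
  assumes "finite S" "t \<in> S" "x \<in> S"
  shows "poly (lagrange_basis S t) x = (if x = t then 1 else 0)"
  using assms by (auto simp: poly_lagrange_basis)

lemma degree_interpolant:
  assumes "finite S" "card S \<le> Suc d"
  shows "degree (interpolant f S) \<le> d"
  unfolding interpolant_def
proof (rule degree_sum_le)
  fix t assume t: "t \<in> S"
  have "degree (\<Prod>y\<in>S - {t}. [:- y, 1:]) \<le> (\<Sum>y\<in>S - {t}. degree [:- y, 1:])"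
    using assms degree_prod_sum_le[of "S - {t}" "\<lambda>y. [:- y, 1:]"] by (simp add: o_def)
  also have "\<dots> = card S - 1"
    using t assms by simp
  finally show "degree (smult (f t) (lagrange_basis S t)) \<le> d"
    using assms(2) unfolding lagrange_basis_def
    by (intro order_trans[OF degree_smult_le]) linarith
qed (use assms in auto)

lemma poly_interpolant_node:
  assumes "finite S" "x \<in> S"
  shows "poly (interpolant f S) x = f x"
proof -
  have "poly (interpolant f S) x = (\<Sum>t\<in>S. f t * (if x = t then 1 else 0))"
    using assms by (simp add: interpolant_def poly_sum poly_lagrange_basis_node)
  also have "\<dots> = f x"
    using assms by (simp add: if_distrib cong: if_cong)
  finally show ?thesis .
qed

lemma interpolant_poly:
  assumes "finite S" "degree p < card S"
  shows "interpolant (poly p) S = p"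
proof (rule poly_eqI_degree)
  show "poly (interpolant (poly p) S) x = poly p x" if "x \<in> S" for x
    using that assms by (simp add: poly_interpolant_node)
  show "degree (interpolant (poly p) S) < card S"
    using degree_interpolant[of S "card S - 1" "poly p"] assms by auto
qed fact

text \<open>
  Newton's form of the interpolation error. It is an identity without any smoothness of \<open>f\<close>:
  both sides expand to the same combination of the values of \<open>f\<close> at \<open>x\<close> and at the nodes.
\<close>
lemma interpolation_remainder:
  assumes "finite S" "x \<notin> S"
  shows "f x - poly (interpolant f S) x = ddiff f (insert x S) * (\<Prod>y\<in>S. x - y)"
proof -
  have nz: "(\<Prod>y\<in>S. x - y) \<noteq> 0"
    using assms by auto
  have "(\<Prod>y\<in>S. x - y) * (\<Sum>t\<in>S. f t / ((t - x) * (\<Prod>y\<in>S - {t}. t - y))) =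
      (\<Sum>t\<in>S. - (f t * poly (lagrange_basis S t) x))"
    unfolding sum_distrib_left
  proof (intro sum.cong refl)
    fix t assume t: "t \<in> S"
    have p: "(\<Prod>y\<in>S. x - y) = (x - t) * (\<Prod>y\<in>S - {t}. x - y)"
      using t assms by (simp add: prod.remove)
    have "(\<Prod>y\<in>S - {t}. t - y) \<noteq> 0" "t \<noteq> x"
      using t assms by auto
    then show "(\<Prod>y\<in>S. x - y) * (f t / ((t - x) * (\<Prod>y\<in>S - {t}. t - y))) =
        - (f t * poly (lagrange_basis S t) x)"
      unfolding p by (simp add: poly_lagrange_basis divide_simps) (simp add: algebra_simps)
  qed
  also have "\<dots> = - poly (interpolant f S) x"
    by (simp add: interpolant_def poly_sum sum_negf)
  finally show ?thesis
    using nz assms by (simp add: ddiff_insert mult.commute[of _ "prod _ _"] distrib_left)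
qed

text \<open>
  A polynomial of degree at most \<open>m\<close> is its own interpolant at \<open>m + 1\<close> nodes, so its
  divided differences of order \<open>m + 1\<close> vanish. This puts these polynomials into the domain of
  the functional.
\<close>
lemma m_convex_on_poly:
  assumes "degree p \<le> m"
  shows "m_convex_on m I (poly p)"
  unfolding m_convex_on_ddiff
proof (intro allI impI)
  fix S assume S: "finite S \<and> card S = m + 2 \<and> S \<subseteq> I"
  then obtain x R where R: "S = insert x R" "x \<notin> R" "card R = m + 1" "finite R"
    by (metis add_2_eq_Suc' add.commute card_Suc_eq finite_insert plus_1_eq_Suc)
  then have "ddiff (poly p) S * (\<Prod>y\<in>R. x - y) = 0"
    using assms interpolation_remainder[of R x "poly p"] by (simp add: interpolant_poly)
  moreover have "(\<Prod>y\<in>R. x - y) \<noteq> 0"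
    using R by auto
  ultimately show "0 \<le> ddiff (poly p) S"
    by simp
qed

section \<open>Monotonicity and boundedness of divided differences\<close>

text \<open>
  The discrete form of ``the \<open>m\<close>-th derivative is increasing'': moving one node to the right
  changes a divided difference of order \<open>m\<close> by a positive multiple of one of order \<open>m + 1\<close>,
  which is nonnegative. The nodes of \<open>U\<close> are moved to those of \<open>V\<close> one at a time. The common
  nodes \<open>S\<close> stay fixed; they serve for endpoints of the interval, which have no room to move
  outwards.
\<close>
lemma ddiff_mono:
  assumes f: "m_convex_on m I f"
    and "finite S" "finite U" "finite V" "S \<inter> U = {}" "S \<inter> V = {}"
    and "card U = card V" "card (S \<union> U) = m + 1" "S \<union> U \<union> V \<subseteq> I"
    and "\<And>u v. u \<in> U \<Longrightarrow> v \<in> V \<Longrightarrow> u < v"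
  shows "ddiff f (S \<union> U) \<le> ddiff f (S \<union> V)"
  using assms(3,2,4-)
proof (induction U arbitrary: S V rule: finite_induct)
  case empty
  then show ?case by simp
next
  case (insert u U)
  then obtain v W where V: "V = insert v W" "v \<notin> W" "card W = card U" "finite W"
    by (metis card_Suc_eq card_insert_disjoint finite_insert)
  have uv: "u < v"
    using insert.prems V by simp
  have vU: "v \<notin> U"
    using insert.prems(8)[of v v] V by auto
  have vS: "v \<notin> S" and uS: "u \<notin> S"
    using insert.prems V by auto
  have c: "card (S \<union> U) = m"
    using insert.prems(6) insert.hyps uS \<open>finite S\<close> by simp
  have "card (insert u (insert v (S \<union> U))) = m + 2"
    using c insert.prems(1) insert.hyps uS vS vU uv by simp
  then have "0 \<le> ddiff f (insert u (insert v (S \<union> U)))"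
    using f insert.prems insert.hyps V unfolding m_convex_on_ddiff by auto
  then have "0 \<le> (v - u) * ddiff f (insert u (insert v (S \<union> U)))"
    using uv by simp
  also have "\<dots> = ddiff f (insert v (S \<union> U)) - ddiff f (insert u (S \<union> U))"
    using insert.prems insert.hyps uS vS vU uv by (subst ddiff_recurrence) auto
  finally have "ddiff f (S \<union> insert u U) \<le> ddiff f (insert v S \<union> U)"
    by simp
  also have "\<dots> \<le> ddiff f (insert v S \<union> W)"
  proof (rule insert.IH)
    show "card (insert v S \<union> U) = m + 1"
      using c vU vS insert by simp
  qed (use insert.prems insert.hyps V vU vS in auto)
  finally show ?case
    using V by simp
qed

text \<open>
  By monotonicity, moving all nodes except \<open>1\<close> to fixed places in \<open>(d, 1)\<close> gives an upper
  bound, and moving all nodes except \<open>-1\<close> to fixed places in \<open>(-1, c)\<close> gives a lower bound.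
  The bound is uniform in \<open>V\<close>, so it survives when nodes coalesce. The nodes in \<open>E\<close> may be
  endpoints, where \<open>f\<close> can jump, but all others have to stay away from the endpoints.
\<close>
lemma ddiff_bounded:
  assumes f: "m_convex_on m {-1..1} f" and E: "E \<subseteq> {-1, 1}" and cd: "-1 < c" "d < 1" "c \<le> d"
  obtains K where "K \<ge> 0"
    "\<And>V. finite V \<Longrightarrow> V \<subseteq> {c..d} \<Longrightarrow> card (E \<union> V) = m + 1 \<Longrightarrow> \<bar>ddiff f (E \<union> V)\<bar> \<le> K"
proof -
  have fE: "finite E"
    using E finite_subset by blast
  \<comment> \<open>the number of nodes that move when \<open>e\<close>, if it is a node, stays\<close>
  define k where "k = (\<lambda>e. m + 1 - card (E \<inter> {e::real}))"
  obtain A where A: "A \<subseteq> {-1<..<c}" "finite A" "card A = k (-1)"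
    using infinite_Ioo[OF cd(1)] infinite_arbitrarily_large by metis
  obtain B where B: "B \<subseteq> {d<..<1}" "finite B" "card B = k 1"
    using infinite_Ioo[OF cd(2)] infinite_arbitrarily_large by metis
  define K where "K = \<bar>ddiff f (E \<inter> {-1} \<union> A)\<bar> + \<bar>ddiff f (E \<inter> {1} \<union> B)\<bar>"
  have "\<bar>ddiff f (E \<union> V)\<bar> \<le> K" if V: "finite V" "V \<subseteq> {c..d}" "card (E \<union> V) = m + 1" for V
  proof -
    have VE: "-1 \<notin> V" "1 \<notin> V"
      using V cd by force+
    have card: "card (E \<union> V - E \<inter> {e}) = k e" for e
      unfolding k_def V(3)[symmetric] using fE V by (subst card_Diff_subset) auto
    have U: "E \<inter> {e} \<union> (E \<union> V - E \<inter> {e}) = E \<union> V" for e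
      by auto
    have "ddiff f (E \<inter> {1} \<union> (E \<union> V - E \<inter> {1})) \<le> ddiff f (E \<inter> {1} \<union> B)"
    proof (rule ddiff_mono[OF f])
      show "u < v" if "u \<in> E \<union> V - E \<inter> {1}" "v \<in> B" for u v
      proof -
        have "u = -1 \<or> u \<le> d"
          using that E V by auto
        moreover have "d < v"
          using that B by auto
        ultimately show ?thesis
          using cd by auto
      qed
      show "E \<inter> {1} \<union> (E \<union> V - E \<inter> {1}) \<union> B \<subseteq> {- 1..1}"
        using E V B cd by fastforce
      show "card (E \<inter> {1} \<union> (E \<union> V - E \<inter> {1})) = m + 1"
        unfolding U by (fact V(3))
    qed (use fE V B card in auto)
    moreover have "ddiff f (E \<inter> {-1} \<union> A) \<le> ddiff f (E \<inter> {-1} \<union> (E \<union> V - E \<inter> {-1}))"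
    proof (rule ddiff_mono[OF f])
      show "u < v" if "v \<in> E \<union> V - E \<inter> {-1}" "u \<in> A" for u v
      proof -
        have "v = 1 \<or> c \<le> v"
          using that E V by auto
        moreover have "u < c"
          using that A by auto
        ultimately show ?thesis
          using cd by auto
      qed
      show "E \<inter> {-1} \<union> A \<union> (E \<union> V - E \<inter> {-1}) \<subseteq> {- 1..1}"
        using E V A cd by fastforce
      have "card (E \<inter> {-1} \<union> A) = card (E \<inter> {-1}) + k (-1)"
        using A fE by (subst card_Un_disjoint) auto
      also have "\<dots> = m + 1"
        unfolding k_def V(3)[symmetric] using fE V card_mono[of "E \<union> V" "E \<inter> {-1}"]
        by (simp add: le_infI1 le_supI1)
      finally show "card (E \<inter> {-1} \<union> A) = m + 1" .
    qed (use fE V A card in auto)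
    ultimately show ?thesis
      unfolding K_def U by linarith
  qed
  moreover have "K \<ge> 0"
    by (simp add: K_def)
  ultimately show ?thesis
    using that by blast
qed

section \<open>Definite quadrature rules and positive functionals\<close>

text \<open>
  If \<open>f\<close> were smooth, \<open>p\<close> could be the Hermite interpolant with simple nodes \<open>E\<close> and double
  nodes \<open>N\<close>: its error is a nonnegative divided difference times \<open>\<Prod>(x - e)\<close> times a square.
  As \<open>f\<close> need not be differentiable, each node \<open>t\<close> of \<open>N\<close> is doubled to \<open>t, t + h\<close>
  instead. The error keeps its sign except in the gaps \<open>(t, t + h)\<close>, where it is \<open>O(h)\<close>: the
  factor \<open>x - t\<close> is at most \<open>h\<close>, and \<open>(t + h - x)\<close> times the divided difference of order
  \<open>m + 1\<close> is a difference of two divided differences of order \<open>m\<close>, which are bounded.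
  The sign \<open>s\<close> is the sign of \<open>\<Prod>(x - e)\<close> on the interval.
\<close>
lemma definite_interpolant:
  assumes f: "m_convex_on m {-1..1} f"
    and N: "finite N" "N \<subseteq> {-1<..<1}" and E: "E \<subseteq> {-1, 1}"
    and card: "card E + 2 * card N = m + 1"
    and s: "\<bar>s\<bar> = 1" "\<And>x. x \<in> {-1..1} \<Longrightarrow> 0 \<le> s * (\<Prod>e\<in>E. x - e)"
    and eps: "\<epsilon> > 0"
  obtains p where "degree p \<le> m" "\<And>t. t \<in> E \<union> N \<Longrightarrow> poly p t = f t"
    "\<And>x. x \<in> {-1..1} \<Longrightarrow> - \<epsilon> \<le> s * (f x - poly p x)"
proof -
  have fE: "finite E"
    using E by (rule finite_subset) simp
  have EN: "E \<inter> N = {}"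
    using subsetD[OF E] subsetD[OF N(2)] by fastforce
  \<comment> \<open>inserting \<open>0\<close> keeps \<open>Min\<close> and \<open>Max\<close> meaningful when \<open>N\<close> is empty\<close>
  define c where "c = Min (insert 0 N)"
  define d' where "d' = Max (insert 0 N)"
  \<comment> \<open>leaves room for the shifted nodes between the last node and \<open>1\<close>\<close>
  define d where "d = (d' + 1) / 2"
  have c: "-1 < c" and d': "d' < 1"
    using N unfolding c_def d'_def by auto
  have Ncd: "c \<le> t" "t \<le> d'" if "t \<in> N" for t
    using N that unfolding c_def d'_def by auto
  have "c \<le> 0" "0 \<le> d'"
    using N unfolding c_def d'_def by auto
  then have d: "d < 1" "c \<le> d"
    using d' unfolding d_def by auto
  obtain K where K: "K \<ge> 0"
    "\<And>V. finite V \<Longrightarrow> V \<subseteq> {c..d} \<Longrightarrow> card (E \<union> V) = m + 1 \<Longrightarrow> \<bar>ddiff f (E \<union> V)\<bar> \<le> K"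
    using ddiff_bounded[OF f E c d] by blast
  define C where "C = 2 * K * 2 ^ m"
  have C: "C \<ge> 0"
    using K by (simp add: C_def)
  \<comment> \<open>gaps that \<open>h\<close> must not bridge: between two nodes, and from the last node to \<open>1\<close>\<close>
  define D where "D = insert (1 - d') ((\<lambda>(a, b). b - a) ` {(a, b) \<in> N \<times> N. a < b})"
  have D: "finite D" "\<And>x. x \<in> D \<Longrightarrow> x > 0"
    using N d' unfolding D_def by (auto intro: finite_subset[of _ "N \<times> N"])
  \<comment> \<open>\<open>C + 1\<close> instead of \<open>C\<close>, which can be \<open>0\<close>\<close>
  define h where "h = min (Min D / 2) (\<epsilon> / (C + 1))"
  have "Min D > 0"
    using D by (auto simp: D_def)
  then have h0: "h > 0"
    using C eps by (simp add: h_def)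
  have hD: "h < x" "2 * h \<le> x" if "x \<in> D" for x
  proof -
    have "Min D \<le> x"
      using that D by simp
    moreover have "h \<le> Min D / 2"
      unfolding h_def by (rule min.cobounded1)
    ultimately show "h < x" "2 * h \<le> x"
      using D(2)[OF that] \<open>Min D > 0\<close> by auto
  qed
  have "C * h \<le> (C + 1) * h"
    using h0 by simp
  also have "\<dots> \<le> (C + 1) * (\<epsilon> / (C + 1))"
    using C by (intro mult_left_mono) (auto simp: h_def)
  also have "\<dots> = \<epsilon>"
    using C by simp
  finally have hC: "C * h \<le> \<epsilon>" .
  define N' where "N' = (\<lambda>t. t + h) ` N"
  have N': "finite N'" "card N' = card N"
    using N by (auto simp: N'_def card_image inj_on_def)
  have N'd: "N' \<subseteq> {c..d}" and Nd: "N \<subseteq> {c..d}"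
  proof -
    have "d' + h \<le> d"
      using hD(2)[of "1 - d'"] by (simp add: D_def d_def)
    then show "N' \<subseteq> {c..d}" "N \<subseteq> {c..d}"
      using Ncd h0 unfolding N'_def by (auto intro: add_increasing2 order_trans) force+
  qed
  have NN': "N \<inter> N' = {}"
  proof (rule ccontr)
    assume "N \<inter> N' \<noteq> {}"
    then obtain t where "t \<in> N" "t + h \<in> N"
      by (auto simp: N'_def)
    then have "h \<in> D"
      using h0 by (force simp: D_def)
    then show False
      using hD by blast
  qed
  have EN': "E \<inter> N' = {}"
    using E N'd c d by force
  define S where "S = E \<union> (N \<union> N')"
  have S: "finite S" "card S = m + 1"
    using card fE N N' EN EN' NN' by (auto simp: S_def card_Un_disjoint Int_Un_distrib)
  have Sl: "S \<subseteq> {-1..1}"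
    using E Nd N'd c d unfolding S_def by fastforce
  define p where "p = interpolant f S"
  have node: "poly p t = f t" if "t \<in> S" for t
    using that S by (simp add: p_def poly_interpolant_node)
  have prod: "(\<Prod>y\<in>S. x - y) = (\<Prod>e\<in>E. x - e) * (\<Prod>t\<in>N. (x - t) * (x - (t + h)))" for x
  proof -
    have "(\<Prod>y\<in>S. x - y) = (\<Prod>e\<in>E. x - e) * ((\<Prod>t\<in>N. x - t) * (\<Prod>t\<in>N'. x - t))"
      unfolding S_def using fE N N' EN EN' NN'
      by (simp add: prod.union_disjoint Int_Un_distrib)
    also have "(\<Prod>t\<in>N'. x - t) = (\<Prod>t\<in>N. x - (t + h))"
      unfolding N'_def by (subst prod.reindex) (auto simp: inj_on_def)
    finally show ?thesis
      by (simp add: prod.distrib)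
  qed
  have "- \<epsilon> \<le> s * (f x - poly p x)" if x: "x \<in> {-1..1}" for x
  proof (cases "x \<in> S")
    case True
    then show ?thesis
      using node eps by simp
  next
    case False
    have r: "f x - poly p x = ddiff f (insert x S) * (\<Prod>y\<in>S. x - y)"
      unfolding p_def using S(1) False by (rule interpolation_remainder)
    show ?thesis
    proof (cases "\<exists>t\<in>N. t < x \<and> x < t + h")
      case False
      have "0 \<le> (x - t) * (x - (t + h))" if "t \<in> N" for t
      proof -
        have "x \<le> t \<or> t + h \<le> x"
          using False that by force
        then show ?thesis
          using h0 by (auto intro: mult_nonneg_nonneg mult_nonpos_nonpos)
      qed
      then have "0 \<le> (\<Prod>t\<in>N. (x - t) * (x - (t + h)))"
        by (intro prod_nonneg) auto
      moreover have "card (insert x S) = m + 2" "insert x S \<subseteq> {-1..1}"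
        using S Sl x \<open>x \<notin> S\<close> by auto
      then have "0 \<le> ddiff f (insert x S)"
        using f S(1) by (auto simp: m_convex_on_ddiff)
      ultimately have "0 \<le> ddiff f (insert x S) * ((s * (\<Prod>e\<in>E. x - e)) * (\<Prod>t\<in>N. (x - t) * (x - (t + h))))"
        using s(2)[OF x] by (simp only: mult_nonneg_nonneg)
      then show ?thesis
        using eps unfolding r prod by (simp add: mult_ac)
    next
      case True
      then obtain t where t: "t \<in> N" "t < x" "x < t + h"
        by blast
      define R where "R = S - {t + h}"
      have tS: "t \<in> S" "t + h \<in> S"
        using t by (auto simp: S_def N'_def)
      have R: "S = insert (t + h) R" "t + h \<notin> R" "finite R" "x \<notin> R" "t \<in> R" "card R = m"
        using tS S False h0 by (auto simp: R_def)
      have ER: "R = E \<union> (N \<union> N' - {t + h})"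
        using t EN' unfolding R_def S_def N'_def by auto
      have xcd: "x \<in> {c..d}"
        using t Nd N'd by (force simp: N'_def)
      have b1: "\<bar>ddiff f S\<bar> \<le> K"
        using K(2)[of "N \<union> N'"] N N' Nd N'd S by (auto simp: S_def)
      have b2: "\<bar>ddiff f (insert x R)\<bar> \<le> K"
      proof -
        have e: "insert x R = E \<union> insert x (N \<union> N' - {t + h})"
          using ER by auto
        have "card (insert x R) = m + 1"
          using R by simp
        then show ?thesis
          unfolding e using N N' Nd N'd xcd by (intro K(2)) auto
      qed
      have "(t + h - x) * ddiff f (insert x S) = ddiff f S - ddiff f (insert x R)"
        using ddiff_recurrence[of R x "t + h" f] R t by simp
      then have b3: "\<bar>(t + h - x) * ddiff f (insert x S)\<bar> \<le> 2 * K"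
        using b1 b2 by linarith
      define Q where "Q = R - {t}"
      have "(\<Prod>y\<in>R. x - y) = (x - t) * (\<Prod>y\<in>Q. x - y)"
        unfolding Q_def using R by (simp add: prod.remove)
      then have pS: "(\<Prod>y\<in>S. x - y) = (x - (t + h)) * ((x - t) * (\<Prod>y\<in>Q. x - y))"
        using R by simp
      have "f x - poly p x =
          - ((t + h - x) * ddiff f (insert x S)) * ((x - t) * (\<Prod>y\<in>Q. x - y))"
        unfolding r pS by (simp add: algebra_simps)
      then have "\<bar>f x - poly p x\<bar> =
          \<bar>(t + h - x) * ddiff f (insert x S)\<bar> * (\<bar>x - t\<bar> * (\<Prod>y\<in>Q. \<bar>x - y\<bar>))"
        by (simp add: abs_mult abs_prod)
      also have "\<dots> \<le> (2 * K) * (h * 2 ^ m)"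
      proof (intro mult_mono b3)
        show "\<bar>x - t\<bar> \<le> h"
          using t by simp
        have "(\<Prod>y\<in>Q. \<bar>x - y\<bar>) \<le> (\<Prod>y\<in>Q. 2)"
        proof (rule prod_mono)
          fix y assume "y \<in> Q"
          then have "y \<in> {-1..1}"
            using Sl by (auto simp: Q_def R_def)
          then show "0 \<le> \<bar>x - y\<bar> \<and> \<bar>x - y\<bar> \<le> 2"
            using x by auto
        qed
        also have "\<dots> \<le> 2 ^ m"
          using R by (simp add: Q_def)
        finally show "(\<Prod>y\<in>Q. \<bar>x - y\<bar>) \<le> 2 ^ m" .
      qed (use K h0 in \<open>auto intro!: prod_nonneg mult_nonneg_nonneg\<close>)
      also have "\<dots> = C * h"
        by (simp add: C_def)
      finally have "\<bar>s * (f x - poly p x)\<bar> \<le> \<epsilon>"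
        using hC s(1) by (simp add: abs_mult)
      then show ?thesis
        by linarith
    qed
  qed
  moreover have "degree p \<le> m"
    unfolding p_def using S by (intro degree_interpolant) auto
  moreover have "poly p t = f t" if "t \<in> E \<union> N" for t
    using node that by (auto simp: S_def)
  ultimately show ?thesis
    using that by blast
qed

text \<open>
  The rule and the functional agree on the interpolant of \<open>definite_interpolant\<close>, and the rule
  does not distinguish this interpolant from \<open>f\<close>. Positivity turns the pointwise one-sided
  estimate into an inequality between \<open>T f\<close> and the value of the rule, up to the integral
  \<open>2 * \<epsilon>\<close> of the constant \<open>\<epsilon>\<close>. With \<open>E = {}\<close> this covers Gauss rules, with
  \<open>E = {-1, 1}\<close> Lobatto rules, and with a single endpoint Radau rules.
\<close>
lemma definite_quadrature:
  assumes X: "fun_space.subspace X" "fun_space.span {g. m_convex_on m {-1..1} g} \<subseteq> X"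
    and T: "linear_functional_on X T" "positive_functional_on {-1..1} X T" "exact_on_degree m T"
    and f: "m_convex_on m {-1..1} f"
    and N: "finite N" "N \<subseteq> {-1<..<1}" and E: "E \<subseteq> {-1, 1}"
    and card: "card E + 2 * card N = m + 1"
    and s: "\<bar>s\<bar> = 1" "\<And>x. x \<in> {-1..1} \<Longrightarrow> 0 \<le> s * (\<Prod>e\<in>E. x - e)"
    and quad: "exact_on_degree m (\<lambda>g. \<Sum>t\<in>E \<union> N. w t * g t)"
  shows "s * (\<Sum>t\<in>E \<union> N. w t * f t) \<le> s * T f"
proof (rule field_le_epsilon)
  fix \<delta> :: real assume "\<delta> > 0"
  define \<epsilon> where "\<epsilon> = \<delta> / 2"
  have eps: "\<epsilon> > 0"
    using \<open>\<delta> > 0\<close> by (simp add: \<epsilon>_def)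
  obtain p where p: "degree p \<le> m" "\<And>t. t \<in> E \<union> N \<Longrightarrow> poly p t = f t"
    "\<And>x. x \<in> {-1..1} \<Longrightarrow> - \<epsilon> \<le> s * (f x - poly p x)"
    by (rule definite_interpolant[OF f N E card s eps]) (blast, rule that)
  have conv: "g \<in> X" if "m_convex_on m {-1..1} g" for g
    using that by (intro subsetD[OF X(2)] fun_space.span_base) simp
  have pX: "poly q \<in> X" if "degree q \<le> m" for q
    by (rule conv[OF m_convex_on_poly[OF that]])
  have fX: "f \<in> X"
    by (rule conv[OF f])
  define q where "q = smult s p - [:\<epsilon>:]"
  have q: "degree q \<le> m"
    unfolding q_def using p(1) degree_smult_le[of s p] by (intro degree_diff_le) (auto intro: order_trans)
  have sfX: "(\<lambda>x. s * f x) \<in> X"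
    using X(1) fX unfolding fun_space.subspace_def by blast
  have "T (poly q) \<le> T (\<lambda>x. s * f x)"
    using T(2) pX[OF q] sfX p(3) unfolding positive_functional_on_def
    by (auto simp: q_def algebra_simps)
  also have "\<dots> = s * T f"
    using T(1) fX unfolding linear_functional_on_def by blast
  finally have "T (poly q) \<le> s * T f" .
  moreover have "T (poly q) = integral {-1..1} (\<lambda>x. s * poly p x - \<epsilon>)"
  proof -
    have "poly q = (\<lambda>x. s * poly p x - \<epsilon>)"
      by (simp add: q_def fun_eq_iff)
    then show ?thesis
      using T(3) q unfolding exact_on_degree_def by metis
  qed
  also have "\<dots> = s * integral {-1..1} (poly p) - 2 * \<epsilon>"
    by (subst integral_diff) (auto intro!: integrable_continuous_real continuous_intros)
  also have "integral {-1..1} (poly p) = (\<Sum>t\<in>E \<union> N. w t * f t)"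
    using quad p(1,2) unfolding exact_on_degree_def
    by (metis (mono_tags, lifting) sum.cong)
  finally show "s * (\<Sum>t\<in>E \<union> N. w t * f t) \<le> s * T f + \<delta>"
    by (simp add: \<epsilon>_def)
qed

section \<open>Integrals of polynomials and interpolatory quadrature\<close>

definition poly_integral :: "real poly \<Rightarrow> real" where
  "poly_integral p = integral {-1..1} (poly p)"

lemma poly_integrable: "poly p integrable_on {a..b::real}"
  by (intro integrable_continuous_real continuous_intros)

lemma poly_integral_add: "poly_integral (p + q) = poly_integral p + poly_integral q"
proof -
  have "poly (p + q) = (\<lambda>x. poly p x + poly q x)"
    by (simp add: fun_eq_iff)
  then show ?thesis
    unfolding poly_integral_def by (metis integral_add poly_integrable)
qed

lemma poly_integral_smult: "poly_integral (smult c p) = c * poly_integral p"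
proof -
  have "poly (smult c p) = (\<lambda>x. c * poly p x)"
    by (simp add: fun_eq_iff)
  then show ?thesis
    unfolding poly_integral_def by simp
qed

lemma poly_integral_0 [simp]: "poly_integral 0 = 0"
  using poly_integral_smult[of 0 0] by simp

lemma poly_integral_sum: "poly_integral (sum p A) = (\<Sum>a\<in>A. poly_integral (p a))"
  by (induction A rule: infinite_finite_induct) (simp_all add: poly_integral_add)

lemma poly_integral_pderiv: "poly_integral (pderiv p) = poly p 1 - poly p (-1)"
proof -
  have "(poly (pderiv p) has_integral poly p 1 - poly p (-1)) {-1..1}"
    by (intro fundamental_theorem_of_calculus)
      (auto simp: has_real_derivative_iff_has_vector_derivative[symmetric]
        intro!: DERIV_subset[OF poly_DERIV])
  then show ?thesis
    unfolding poly_integral_def by (rule integral_unique)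
qed

lemma poly_integral_by_parts:
  "poly_integral (pderiv p * q) =
     poly p 1 * poly q 1 - poly p (-1) * poly q (-1) - poly_integral (p * pderiv q)"
proof -
  have "pderiv (p * q) = pderiv p * q + p * pderiv q"
    by (simp add: pderiv_mult mult_ac add_ac)
  then show ?thesis
    using poly_integral_pderiv[of "p * q"] by (simp add: poly_integral_add)
qed

text \<open>
  Integrate by parts \<open>k\<close> times: no boundary term survives, and the \<open>k\<close>-th derivative of
  \<open>q\<close> is \<open>0\<close>.
\<close>
lemma poly_integral_higher_pderiv_mult:
  assumes "\<And>i. i < k \<Longrightarrow> poly ((pderiv ^^ i) g) 1 = 0 \<and> poly ((pderiv ^^ i) g) (-1) = 0"
    and "degree q < k"
  shows "poly_integral ((pderiv ^^ k) g * q) = 0"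
  using assms
proof (induction k arbitrary: q)
  case (Suc k)
  have "poly_integral ((pderiv ^^ k) g * pderiv q) = 0"
  proof (cases "degree q = 0")
    case True
    then have "pderiv q = 0"
      using pderiv_eq_0_iff by blast
    then show ?thesis
      by simp
  next
    case False
    then show ?thesis
      using Suc.prems by (intro Suc.IH) (auto simp: degree_pderiv)
  qed
  then show ?case
    using Suc.prems(1)[of k] by (simp add: poly_integral_by_parts)
qed simp

text \<open>
  Gauss's argument: divide \<open>p\<close> by the node polynomial \<open>W\<close>. The quotient part integrates to
  \<open>0\<close> by orthogonality and vanishes at the nodes, and the remainder equals its interpolant.
\<close>
lemma interpolatory_quadrature:
  assumes W: "finite N" "card N = degree W" "W \<noteq> 0" "\<And>t. t \<in> N \<Longrightarrow> poly W t = 0"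
    and orth: "\<And>q. degree W + degree q \<le> d \<Longrightarrow> poly_integral (W * q) = 0"
    and p: "degree p \<le> d"
  shows "poly_integral p = (\<Sum>t\<in>N. poly_integral (lagrange_basis N t) * poly p t)"
proof -
  define q where "q = p div W"
  define r where "r = p mod W"
  have p_eq: "p = W * q + r"
    by (simp add: q_def r_def)
  have rN: "poly r t = poly p t" if "t \<in> N" for t
    using that W(4) by (simp add: p_eq)
  have Wq: "poly_integral (W * q) = 0"
  proof (cases "q = 0")
    case False
    then have dWq: "degree (W * q) = degree W + degree q"
      using W(3) by (intro degree_mult_eq)
    have "degree p = degree (W * q)"
    proof (cases "r = 0")
      case False
      then have "degree r < degree (W * q)"
        using W(3) degree_mod_less[of W p] dWq by (auto simp: r_def)
      then show ?thesis
        unfolding p_eq by (rule degree_add_eq_left)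
    qed (simp add: p_eq)
    then have "degree W + degree q \<le> d"
      using p dWq by simp
    then show ?thesis
      by (rule orth)
  qed simp
  have "r = interpolant (poly r) N"
  proof (cases "degree W = 0")
    case True
    then have "r = 0" "N = {}"
      using W degree_mod_less[of W p] by (auto simp: r_def)
    then show ?thesis
      by (simp add: interpolant_def)
  next
    case False
    then have "degree r < card N"
      using W degree_mod_less[of W p] by (auto simp: r_def)
    then show ?thesis
      using interpolant_poly[of N r] W by simp
  qed
  then have "poly_integral r = poly_integral (interpolant (poly r) N)"
    by (rule arg_cong)
  also have "\<dots> = (\<Sum>t\<in>N. poly_integral (lagrange_basis N t) * poly p t)"
    unfolding interpolant_def poly_integral_sum poly_integral_smult
    by (intro sum.cong) (simp_all add: rN)
  finally have "poly_integral r = (\<Sum>t\<in>N. poly_integral (lagrange_basis N t) * poly p t)" .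
  with Wq show ?thesis
    by (simp add: p_eq poly_integral_add)
qed

section \<open>Legendre polynomials\<close>

lemma linear_power_dvd_higher_pderiv:
  "[:- a, 1:] ^ k dvd (pderiv ^^ i) ([:- a, 1:] ^ (k + i) * (q :: real poly))"
proof (induction i arbitrary: q)
  case (Suc i)
  have "pderiv ([:- a, 1:] ^ Suc (k + i) * q) =
          [:- a, 1:] ^ (k + i) * (smult (real (Suc (k + i))) q + [:- a, 1:] * pderiv q)"
    by (simp only: pderiv_mult pderiv_power_Suc) (simp add: pderiv_pCons algebra_simps)
  then show ?case
    by (simp add: funpow_Suc_right Suc.IH del: funpow.simps power_Suc)
qed simp

lemma poly_higher_pderiv_linear_power:
  "poly ((pderiv ^^ k) ([:- a, 1:] ^ k * q)) a = fact k * poly q (a :: real)"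
proof (induction k arbitrary: q)
  case (Suc k)
  have "pderiv ([:- a, 1:] ^ Suc k * q) =
          [:- a, 1:] ^ k * (smult (real (Suc k)) q + [:- a, 1:] * pderiv q)"
    by (simp only: pderiv_mult pderiv_power_Suc) (simp add: pderiv_pCons algebra_simps)
  then show ?case
    by (simp add: funpow_Suc_right Suc.IH del: funpow.simps power_Suc)
qed simp

abbreviation x_square_minus_1 :: "real poly" where
  "x_square_minus_1 \<equiv> [:-1, 0, 1:]"

lemma x_square_minus_1_factors:
  "x_square_minus_1 ^ n = [:- a, 1:] ^ n * [:a, 1:] ^ n" if "a\<^sup>2 = 1"
proof -
  have "x_square_minus_1 = [:- a, 1:] * [:a, 1:]"
    using that by (simp add: power2_eq_square)
  then show ?thesis
    by (simp only: power_mult_distrib)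
qed

lemma poly_higher_pderiv_rodrigues:
  assumes "i < n" "a\<^sup>2 = 1"
  shows "poly ((pderiv ^^ i) (x_square_minus_1 ^ n)) a = 0"
proof -
  have "[:- a, 1:] ^ (n - i) dvd (pderiv ^^ i) (x_square_minus_1 ^ n)"
    using linear_power_dvd_higher_pderiv[of a "n - i" i "[:a, 1:] ^ n"] assms
    by (simp add: x_square_minus_1_factors)
  moreover have "[:- a, 1:] dvd [:- a, 1:] ^ (n - i)"
    using assms by (intro dvd_power) simp
  ultimately show ?thesis
    by (meson dvd_trans poly_eq_0_iff_dvd)
qed

lemma poly_legendre_pm_1:
  assumes "a\<^sup>2 = 1"
  shows "poly (legendre n) a = a ^ n"
proof -
  have "poly ((pderiv ^^ n) (x_square_minus_1 ^ n)) a = fact n * (2 * a) ^ n"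
    using assms by (simp add: x_square_minus_1_factors poly_higher_pderiv_linear_power)
  then show ?thesis
    by (simp add: legendre_def power_mult_distrib)
qed

lemma poly_legendre_pm_1_square:
  assumes "a\<^sup>2 = 1"
  shows "(poly (legendre n) a)\<^sup>2 = 1"
proof -
  have "(a ^ n)\<^sup>2 = (a\<^sup>2) ^ n"
    by (simp add: mult.commute flip: power_mult)
  then show ?thesis
    using assms by (simp add: poly_legendre_pm_1)
qed

lemma degree_legendre [simp]: "degree (legendre n) = n"
  by (simp add: legendre_def degree_higher_pderiv degree_power_eq)

lemma legendre_nonzero [simp]: "legendre n \<noteq> 0"
  using poly_legendre_1[of n] by auto

lemma poly_integral_legendre_mult:
  assumes "degree q < n"
  shows "poly_integral (legendre n * q) = 0"
proof -
  have "poly_integral ((pderiv ^^ n) (x_square_minus_1 ^ n) * q) = 0"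
    by (rule poly_integral_higher_pderiv_mult)
      (use assms in \<open>simp_all add: poly_higher_pderiv_rodrigues\<close>)
  then show ?thesis
    by (simp add: legendre_def poly_integral_smult)
qed

lemma higher_pderiv_diff: "(pderiv ^^ k) (p - q) = (pderiv ^^ k) p - (pderiv ^^ k) q"
  for p q :: "real poly"
  by (induction k) (simp_all add: pderiv_diff)

lemma poly_extensionality: "(\<And>x. poly p x = poly q x) \<Longrightarrow> p = q" for p q :: "real poly"
  by (metis poly_eq_poly_eq_iff ext)

text \<open>
  Leibniz' rule with a linear factor. For \<open>k = 0\<close> the truncated \<open>k - 1\<close> is harmless, because
  the coefficient is \<open>0\<close>.
\<close>
lemma higher_pderiv_X_mult:
  "(pderiv ^^ k) ([:0, 1:] * p) = [:0, 1:] * (pderiv ^^ k) p + smult (real k) ((pderiv ^^ (k - 1)) p)"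
  for p :: "real poly"
proof (induction k)
  case (Suc k)
  have "(pderiv ^^ Suc k) ([:0, 1:] * p) =
      pderiv ([:0, 1:] * (pderiv ^^ k) p + smult (real k) ((pderiv ^^ (k - 1)) p))"
    unfolding Suc.IH[symmetric] by simp
  also have "\<dots> = [:0, 1:] * (pderiv ^^ Suc k) p + smult (real (Suc k)) ((pderiv ^^ (Suc k - 1)) p)"
    by (cases k; rule poly_extensionality)
      (simp_all add: pderiv_add pderiv_smult pderiv_mult pderiv_pCons algebra_simps)
  finally show ?case .
qed simp

text \<open>
  The auxiliary \<open>A\<close> is the \<open>(n - 1)\<close>-st derivative in Rodrigues' formula, an antiderivative of
  the Legendre polynomial. Leibniz' rule gives two expressions for the next Legendre polynomial:
  from \<open>((x\<^sup>2 - 1) ^ (n + 1))' = 2 (n + 1) x (x\<^sup>2 - 1) ^ n\<close> and from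
  \<open>(x\<^sup>2 - 1) ^ (n + 1) = (x\<^sup>2 - 1) (x\<^sup>2 - 1) ^ n\<close>. Eliminating \<open>A\<close> between them yields the
  third equation.
\<close>
lemma legendre_recurrences:
  assumes "n \<ge> 1"
  obtains A where "pderiv A = legendre n"
    "legendre (Suc n) = [:0, 1:] * legendre n + smult (real n) A"
    "x_square_minus_1 * pderiv (legendre n) = smult (real n + 1) (legendre (Suc n) - [:0, 1:] * legendre n)"
proof -
  define c where "c = 1 / (2 ^ n * fact n :: real)"
  define G where "G = x_square_minus_1 ^ n"
  define A where "A = smult c ((pderiv ^^ (n - 1)) G)"
  have P: "legendre n = smult c ((pderiv ^^ n) G)"
    by (simp add: legendre_def c_def G_def)
  have A: "pderiv A = legendre n"
    using assms unfolding A_def P by (cases n) (simp_all add: pderiv_smult)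
  have c': "1 / (2 ^ Suc n * fact (Suc n)) = c / (2 * (real n + 1))"
    by (simp add: c_def field_simps)
  have P': "legendre (Suc n) = smult (c / (2 * (real n + 1))) ((pderiv ^^ Suc n) (x_square_minus_1 * G))"
    unfolding legendre_def c' G_def by simp
  have "pderiv (x_square_minus_1 * G) = smult (2 * (real n + 1)) ([:0, 1:] * G)"
    using pderiv_power_Suc[of x_square_minus_1 n] by (simp add: G_def pderiv_pCons algebra_simps)
  then have "(pderiv ^^ Suc n) (x_square_minus_1 * G) =
      smult (2 * (real n + 1)) ((pderiv ^^ n) ([:0, 1:] * G))"
    by (simp only: funpow_Suc_right o_apply higher_pderiv_smult)
  then have "legendre (Suc n) = smult c ((pderiv ^^ n) ([:0, 1:] * G))"
    unfolding P' by (simp add: add_pos_nonneg)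
  also have "\<dots> = [:0, 1:] * legendre n + smult (real n) A"
    unfolding higher_pderiv_X_mult P A_def by (simp add: smult_add_right mult.commute)
  finally have r1: "legendre (Suc n) = [:0, 1:] * legendre n + smult (real n) A" .
  let ?D = "\<lambda>k. (pderiv ^^ k) G"
  have "x_square_minus_1 * G = [:0, 1:] * ([:0, 1:] * G) - G"
    by (simp add: algebra_simps)
  then have "(pderiv ^^ Suc n) (x_square_minus_1 * G) =
      (pderiv ^^ Suc n) ([:0, 1:] * ([:0, 1:] * G)) - ?D (Suc n)"
    by (simp only: higher_pderiv_diff)
  also have "\<dots> = [:0, 1:] * ([:0, 1:] * ?D (Suc n) + smult (real n + 1) (?D n))
      + smult (real n + 1) ([:0, 1:] * ?D n + smult (real n) (?D (n - 1))) - ?D (Suc n)"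
    by (simp only: higher_pderiv_X_mult diff_Suc_1 of_nat_Suc add.commute[of 1])
  finally have L: "legendre (Suc n) = smult (c / (2 * (real n + 1)))
      ([:0, 1:] * ([:0, 1:] * ?D (Suc n) + smult (real n + 1) (?D n))
      + smult (real n + 1) ([:0, 1:] * ?D n + smult (real n) (?D (n - 1))) - ?D (Suc n))"
    unfolding P' by simp
  have dP: "pderiv (legendre n) = smult c (?D (Suc n))"
    by (simp add: P pderiv_smult)
  have r2: "x_square_minus_1 * pderiv (legendre n) =
      smult (real n + 1) (legendre (Suc n) - [:0, 1:] * legendre n)"
  proof (rule poly_extensionality)
    fix x
    have n: "real n + 1 \<noteq> 0"
      by (metis of_nat_Suc add.commute of_nat_eq_0_iff nat.distinct(1))
    have "(2 * (real n + 1)) * poly (legendre (Suc n)) x =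
        c * (x * (x * poly (?D (Suc n)) x + (real n + 1) * poly (?D n) x)
          + (real n + 1) * (x * poly (?D n) x + real n * poly (?D (n - 1)) x)
          - poly (?D (Suc n)) x)"
      unfolding L using n by simp
    moreover have "poly (legendre (Suc n)) x = x * poly (legendre n) x + real n * (c * poly (?D (n - 1)) x)"
      unfolding r1 A_def by simp
    ultimately show "poly (x_square_minus_1 * pderiv (legendre n)) x =
        poly (smult (real n + 1) (legendre (Suc n) - [:0, 1:] * legendre n)) x"
      unfolding dP unfolding P by (simp del: funpow.simps) algebra
  qed
  show ?thesis
    using that[OF A r1 r2] .
qed

text \<open>
  The two recurrences make \<open>(x\<^sup>2 - 1) P'\<close> a multiple of an antiderivative of \<open>P\<close>.
\<close>
lemma legendre_ode:
  "pderiv (x_square_minus_1 * pderiv (legendre n)) = smult (real n * (real n + 1)) (legendre n)"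
proof (cases "n = 0")
  case True
  then show ?thesis
    by (simp add: legendre_def)
next
  case False
  then obtain A where A: "pderiv A = legendre n"
    "legendre (Suc n) = [:0, 1:] * legendre n + smult (real n) A"
    "x_square_minus_1 * pderiv (legendre n) = smult (real n + 1) (legendre (Suc n) - [:0, 1:] * legendre n)"
    using legendre_recurrences[of n] by auto
  have "x_square_minus_1 * pderiv (legendre n) = smult (real n + 1) (smult (real n) A)"
    unfolding A(3) unfolding A(2) by simp
  then have "pderiv (x_square_minus_1 * pderiv (legendre n)) = smult (real n + 1) (smult (real n) (legendre n))"
    by (simp only: pderiv_smult A(1))
  then show ?thesis
    by (simp add: mult.commute)
qed

lemma poly_legendre_ode:
  "(x\<^sup>2 - 1) * poly (pderiv (pderiv (legendre n))) x + 2 * x * poly (pderiv (legendre n)) x =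
     real n * (real n + 1) * poly (legendre n) x"
proof -
  have "poly (pderiv (x_square_minus_1 * pderiv (legendre n))) x = real n * (real n + 1) * poly (legendre n) x"
    unfolding legendre_ode by simp
  then show ?thesis
    unfolding pderiv_mult by (simp add: pderiv_pCons power2_eq_square algebra_simps)
qed

section \<open>Roots of the Legendre polynomials and of their derivatives\<close>

text \<open>
  Rolle's theorem between consecutive elements of \<open>S\<close>, by splitting off the largest one. The
  new roots lie in the open interval, which separates them from the endpoints.
\<close>
lemma pderiv_roots_between:
  fixes S :: "real set"
  assumes "finite S" "card S = Suc k" "S \<subseteq> {a..b}" "\<And>x. x \<in> S \<Longrightarrow> poly p x = 0"
  obtains R where "finite R" "card R = k" "R \<subseteq> {a<..<b}" "\<And>x. x \<in> R \<Longrightarrow> poly (pderiv p) x = 0"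
proof -
  have "\<exists>R. finite R \<and> card R = k \<and> R \<subseteq> {a<..<b} \<and> (\<forall>x\<in>R. poly (pderiv p) x = 0)"
    using assms
  proof (induction k arbitrary: S b)
    case 0
    then show ?case
      by (intro exI[of _ "{}"]) simp
  next
    case (Suc k)
    have "S \<noteq> {}"
      using Suc.prems by auto
    define M where "M = Max S"
    define S' where "S' = S - {M}"
    have M: "M \<in> S" "\<And>x. x \<in> S \<Longrightarrow> x \<le> M"
      using Suc.prems \<open>S \<noteq> {}\<close> by (simp_all add: M_def)
    have S': "finite S'" "card S' = Suc k"
      using Suc.prems M by (simp_all add: S'_def)
    then have "S' \<noteq> {}"
      by auto
    define M' where "M' = Max S'"
    have M': "M' \<in> S'" "\<And>x. x \<in> S' \<Longrightarrow> x \<le> M'"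
      using S' \<open>S' \<noteq> {}\<close> by (simp_all add: M'_def)
    have MM': "M' < M"
      using M' M by (force simp: S'_def)
    have "S' \<subseteq> {a..M'}"
      using M'(2) Suc.prems(3) by (fastforce simp: S'_def)
    moreover have "poly p x = 0" if "x \<in> S'" for x
      using that Suc.prems(4) by (simp add: S'_def)
    ultimately obtain R where R: "finite R" "card R = k" "R \<subseteq> {a<..<M'}"
      "\<forall>x\<in>R. poly (pderiv p) x = 0"
      using Suc.IH[OF S'] by blast
    \<comment> \<open>the root gained between the two largest elements\<close>
    obtain z where z: "M' < z" "z < M" "poly p M - poly p M' = (M - M') * poly (pderiv p) z"
      using poly_MVT[OF MM'] by blast
    have "poly p M = 0" "poly p M' = 0"
      using Suc.prems(4) M(1) M'(1) by (simp_all add: S'_def)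
    then have "poly (pderiv p) z = 0"
      using z(3) MM' by simp
    moreover have "z \<notin> R"
      using R(3) z(1) by auto
    moreover have "a < z" "z < b"
      using M M' z Suc.prems(3) by (force simp: S'_def)+
    moreover have "R \<subseteq> {a<..<b}"
      using R(3) z \<open>z < b\<close> by fastforce
    ultimately show ?case
      using R by (intro exI[of _ "insert z R"]) auto
  qed
  then show ?thesis
    using that by blast
qed

text \<open>
  As long as \<open>k < n\<close>, the endpoints are also roots of the \<open>k\<close>-th derivative, so that each
  application of Rolle's theorem gains one interior root.
\<close>
lemma higher_pderiv_rodrigues_roots:
  "k \<le> n \<Longrightarrow> \<exists>R. finite R \<and> card R = k \<and> R \<subseteq> {-1<..<1} \<and>
     (\<forall>x\<in>R. poly ((pderiv ^^ k) (x_square_minus_1 ^ n)) x = 0)"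
proof (induction k)
  case 0
  then show ?case
    by (intro exI[of _ "{}"]) simp
next
  case (Suc k)
  then obtain R where R: "finite R" "card R = k" "R \<subseteq> {-1<..<1}"
    "\<forall>x\<in>R. poly ((pderiv ^^ k) (x_square_minus_1 ^ n)) x = 0"
    by auto
  define S where "S = insert (-1) (insert 1 R)"
  have S: "finite S" "S \<subseteq> {-1..1}"
    using R(1,3) by (auto simp: S_def)
  moreover have "-1 \<notin> insert 1 R" "1 \<notin> R"
    using R(3) by auto
  then have "card S = Suc (Suc k)"
    using R(1,2) by (simp add: S_def)
  moreover have "poly ((pderiv ^^ k) (x_square_minus_1 ^ n)) x = 0" if "x \<in> S" for x
    using that R(4) Suc.prems by (auto simp: S_def poly_higher_pderiv_rodrigues)
  ultimately obtain R' where R': "finite R'" "card R' = Suc k" "R' \<subseteq> {-1<..<1}"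
    "\<And>x. x \<in> R' \<Longrightarrow> poly (pderiv ((pderiv ^^ k) (x_square_minus_1 ^ n))) x = 0"
    using pderiv_roots_between[of S "Suc k" "-1" 1] by blast
  then show ?case
    by auto
qed

lemma all_roots_in:
  fixes p :: "real poly"
  assumes "p \<noteq> 0" "card R = degree p" "finite R" "\<And>x. x \<in> R \<Longrightarrow> poly p x = 0"
  shows "{x. poly p x = 0} = R"
proof (rule sym, rule card_seteq)
  show "finite {x. poly p x = 0}"
    using assms by (simp add: poly_roots_finite)
  show "card {x. poly p x = 0} \<le> card R"
    using assms card_poly_roots_bound[of p] by simp
qed (use assms in auto)

lemma legendre_roots:
  "finite {x. poly (legendre n) x = 0}"
  "card {x. poly (legendre n) x = 0} = n"
  "{x. poly (legendre n) x = 0} \<subseteq> {-1<..<1}"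
proof -
  obtain R where R: "finite R" "card R = n" "R \<subseteq> {-1<..<1}"
    "\<forall>x\<in>R. poly ((pderiv ^^ n) (x_square_minus_1 ^ n)) x = 0"
    using higher_pderiv_rodrigues_roots[of n n] by auto
  have "{x. poly (legendre n) x = 0} = R"
  proof (rule all_roots_in)
    show "poly (legendre n) x = 0" if "x \<in> R" for x
      using R(4) that by (simp add: legendre_def)
  qed (use R in simp_all)
  then show "finite {x. poly (legendre n) x = 0}" "card {x. poly (legendre n) x = 0} = n"
    "{x. poly (legendre n) x = 0} \<subseteq> {-1<..<1}"
    using R by auto
qed

lemma pderiv_legendre_roots:
  assumes "n \<ge> 1"
  shows "finite {x. poly (pderiv (legendre n)) x = 0}"
  "card {x. poly (pderiv (legendre n)) x = 0} = n - 1"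
  "{x. poly (pderiv (legendre n)) x = 0} \<subseteq> {-1<..<1}"
proof -
  have c: "card {x. poly (legendre n) x = 0} = Suc (n - 1)"
    using assms legendre_roots(2) by simp
  have sub: "{x. poly (legendre n) x = 0} \<subseteq> {-1..1}"
    using legendre_roots(3)[of n] by fastforce
  obtain R where R: "finite R" "card R = n - 1" "R \<subseteq> {-1<..<1}"
    "\<And>x. x \<in> R \<Longrightarrow> poly (pderiv (legendre n)) x = 0"
    using pderiv_roots_between[OF legendre_roots(1) c sub, of "legendre n"] by blast
  have "{x. poly (pderiv (legendre n)) x = 0} = R"
    by (rule all_roots_in) (use R assms in \<open>auto simp: pderiv_eq_0_iff degree_pderiv\<close>)
  then show "finite {x. poly (pderiv (legendre n)) x = 0}"
    "card {x. poly (pderiv (legendre n)) x = 0} = n - 1"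
    "{x. poly (pderiv (legendre n)) x = 0} \<subseteq> {-1<..<1}"
    using R by auto
qed

section \<open>Exactness of the Gauss-Legendre rule\<close>

lemma sum_eq_single:
  fixes g :: "'a \<Rightarrow> 'b :: comm_monoid_add"
  assumes "finite N" "t \<in> N" "\<And>x. x \<in> N - {t} \<Longrightarrow> g x = 0"
  shows "sum g N = g t"
  using assms by (simp add: sum.remove)

lemma exact_on_degree_iff_poly_integral:
  "exact_on_degree m T \<longleftrightarrow> (\<forall>p. degree p \<le> m \<longrightarrow> T (poly p) = poly_integral p)"
  by (simp add: exact_on_degree_def poly_integral_def)

lemma sum_reciprocals: "-1 < t \<Longrightarrow> t < 1 \<Longrightarrow> 1 / (1 - t) + 1 / (1 + t) = 2 / (1 - t\<^sup>2)" for t :: real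
proof -
  assume "-1 < t" "t < 1"
  then have "1 / (1 - t) + 1 / (1 + t) = (1 * (1 + t) + 1 * (1 - t)) / ((1 - t) * (1 + t))"
    by (intro add_frac_eq) simp_all
  moreover have "(1 - t) * (1 + t) = 1 - t\<^sup>2"
    by (simp add: power2_eq_square algebra_simps)
  ultimately show ?thesis
    by simp
qed

lemma mult_eq_divide_of_square: "U * a\<^sup>2 = c \<Longrightarrow> a \<noteq> 0 \<Longrightarrow> a * U = c / a" for U a c :: real
  by (auto simp: power2_eq_square)

text \<open>
  The node polynomial \<open>P\<close> is orthogonal to all polynomials of degree below \<open>n\<close>, so the
  interpolatory rule with weights \<open>w\<close> is exact. To compute \<open>w t\<close>, put \<open>u = P / (x - t)\<close>.
  The rule takes the same value \<open>J = w t * (P' t)\<^sup>2\<close> on \<open>u\<^sup>2\<close> and on \<open>u P'\<close>. On the other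
  hand \<open>2 u P' = u\<^sup>2 + ((x - t) u\<^sup>2)'\<close>, and the integral of the last term is read off at the
  endpoints, where \<open>P\<^sup>2 = 1\<close>. Hence \<open>J = 2 / (1 - t\<^sup>2)\<close>, and the recurrence for
  \<open>(x\<^sup>2 - 1) P'\<close> brings this into the form with the next Legendre polynomial.
\<close>
lemma gauss_legendre_exact:
  assumes "n \<ge> 1"
  shows "exact_on_degree (2 * n - 1) (gauss_legendre n)"
proof -
  let ?P = "legendre n"
  define N where "N = {x. poly ?P x = 0}"
  define w where "w = (\<lambda>t. poly_integral (lagrange_basis N t))"
  note N = legendre_roots[of n, folded N_def]
  have quad: "poly_integral p = (\<Sum>t\<in>N. w t * poly p t)" if "degree p \<le> 2 * n - 1" for p
    unfolding w_def
  proof (rule interpolatory_quadrature)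
    show "poly_integral (?P * q) = 0" if "degree ?P + degree q \<le> 2 * n - 1" for q
      using that assms by (intro poly_integral_legendre_mult) simp
  qed (use N that in \<open>auto simp: N_def\<close>)
  have weight: "w t = 2 * (1 - t\<^sup>2) / ((real n + 1)\<^sup>2 * (poly (legendre (n + 1)) t)\<^sup>2)" if t: "t \<in> N" for t
  proof -
    obtain u where u: "?P = [:- t, 1:] * u"
      using t unfolding N_def by (auto simp: poly_eq_0_iff_dvd dvd_def)
    have u0: "u \<noteq> 0"
      using u by auto
    have deg: "Suc (degree u) = n"
      using degree_mult_eq[of "[:- t, 1:]" u] u0 unfolding u[symmetric] by simp
    have tI: "-1 < t" "t < 1"
      using t N(3) by auto
    have dP: "pderiv ?P = u + [:- t, 1:] * pderiv u"
      unfolding u by (simp only: pderiv_mult) (simp add: pderiv_pCons)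
    have uN: "poly u x = 0" if "x \<in> N - {t}" for x
    proof -
      have "poly ?P x = 0" "x \<noteq> t"
        using that by (auto simp: N_def)
      then show ?thesis
        unfolding u by simp
    qed
    have ut: "poly u t = poly (pderiv ?P) t"
      unfolding dP by simp
    define J where "J = w t * (poly u t)\<^sup>2"
    have J1: "poly_integral (u * u) = J"
    proof -
      have "degree (u * u) \<le> 2 * n - 1"
        using deg degree_mult_le[of u u] by linarith
      then have "poly_integral (u * u) = (\<Sum>x\<in>N. w x * poly (u * u) x)"
        by (rule quad)
      also have "\<dots> = w t * poly (u * u) t"
        by (rule sum_eq_single) (use N t uN in auto)
      finally show ?thesis
        by (simp add: J_def power2_eq_square)
    qed
    have J2: "poly_integral (u * pderiv ?P) = J"
    proof -
      have "degree (u * pderiv ?P) \<le> 2 * n - 1"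
        using deg degree_mult_le[of u "pderiv ?P"] by (simp add: degree_pderiv)
      then have "poly_integral (u * pderiv ?P) = (\<Sum>x\<in>N. w x * poly (u * pderiv ?P) x)"
        by (rule quad)
      also have "\<dots> = w t * poly (u * pderiv ?P) t"
        by (rule sum_eq_single) (use N t uN in auto)
      finally show ?thesis
        by (simp add: J_def power2_eq_square ut)
    qed
    have ends: "(poly u 1)\<^sup>2 * (1 - t)\<^sup>2 = 1" "(poly u (-1))\<^sup>2 * (1 + t)\<^sup>2 = 1"
    proof -
      have "poly u 1 * (1 - t) = poly ?P 1" "poly u (-1) * (1 + t) = - poly ?P (-1)"
        unfolding u by (simp_all add: algebra_simps)
      then have "(poly u 1 * (1 - t))\<^sup>2 = 1" "(poly u (-1) * (1 + t))\<^sup>2 = 1"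
        by (simp_all add: poly_legendre_pm_1_square)
      then show "(poly u 1)\<^sup>2 * (1 - t)\<^sup>2 = 1" "(poly u (-1))\<^sup>2 * (1 + t)\<^sup>2 = 1"
        by (simp_all only: power_mult_distrib)
    qed
    have "smult 2 (u * pderiv ?P) = u * u + pderiv ([:- t, 1:] * (u * u))"
      unfolding dP pderiv_mult by (rule poly_extensionality) (simp add: pderiv_pCons algebra_simps)
    from arg_cong[OF this, of poly_integral]
    have "2 * J = J + poly_integral (pderiv ([:- t, 1:] * (u * u)))"
      by (simp only: poly_integral_add poly_integral_smult J1 J2)
    also have "poly_integral (pderiv ([:- t, 1:] * (u * u))) =
        (1 - t) * (poly u 1)\<^sup>2 + (1 + t) * (poly u (-1))\<^sup>2"
      unfolding poly_integral_pderiv by (simp add: power2_eq_square algebra_simps)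
    also have "\<dots> = 1 / (1 - t) + 1 / (1 + t)"
      using mult_eq_divide_of_square[OF ends(1)] mult_eq_divide_of_square[OF ends(2)] tI by simp
    also have "\<dots> = 2 / (1 - t\<^sup>2)"
      using tI by (rule sum_reciprocals)
    finally have "J = 2 / (1 - t\<^sup>2)"
      by simp
    then have W: "w t * (poly (pderiv ?P) t)\<^sup>2 = 2 / (1 - t\<^sup>2)"
      by (simp add: J_def ut)
    have R: "(t\<^sup>2 - 1) * poly (pderiv ?P) t = (real n + 1) * poly (legendre (n + 1)) t"
    proof -
      have "x_square_minus_1 * pderiv ?P = smult (real n + 1) (legendre (Suc n) - [:0, 1:] * ?P)"
        using legendre_recurrences[OF assms] by metis
      from arg_cong[OF this, of "\<lambda>p. poly p t"] show ?thesis
        using t by (simp add: N_def power2_eq_square algebra_simps)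
    qed
    have d: "1 - t\<^sup>2 > 0"
      using tI by (simp add: abs_square_less_1)
    then have "poly (pderiv ?P) t \<noteq> 0"
      using W by auto
    then have nz: "((t\<^sup>2 - 1) * poly (pderiv ?P) t)\<^sup>2 \<noteq> 0"
      using d by simp
    have "w t * ((t\<^sup>2 - 1) * poly (pderiv ?P) t)\<^sup>2 =
        (1 - t\<^sup>2)\<^sup>2 * (w t * (poly (pderiv ?P) t)\<^sup>2)"
      by (simp add: power_mult_distrib power2_commute[of "t\<^sup>2" 1])
    also have "\<dots> = 2 * (1 - t\<^sup>2)"
      unfolding W using d by (simp add: power2_eq_square[of "1 - t\<^sup>2"])
    finally have "w t = 2 * (1 - t\<^sup>2) / ((t\<^sup>2 - 1) * poly (pderiv ?P) t)\<^sup>2"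
      using nz nonzero_eq_divide_eq by blast
    then show ?thesis
      by (simp only: R power_mult_distrib)
  qed
  have "gauss_legendre n g = (\<Sum>t\<in>N. w t * g t)" for g
    unfolding gauss_legendre_def N_def[symmetric] by (rule sum.cong) (simp_all only: weight)
  then show ?thesis
    unfolding exact_on_degree_iff_poly_integral using quad by simp
qed

section \<open>Exactness of the Lobatto rule\<close>

text \<open>
  The endpoint weights fit the general pattern, as \<open>P\<^sup>2 = 1\<close> there. The two-point rule is the
  case without interior nodes.
\<close>
lemma lobatto_eq_sum:
  assumes "n \<ge> 1"
  shows "lobatto (n + 1) g = (\<Sum>t\<in>{-1, 1} \<union> {x. poly (pderiv (legendre n)) x = 0}.
           2 / (real n * (real n + 1) * (poly (legendre n) t)\<^sup>2) * g t)"
proof -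
  let ?N = "{x. poly (pderiv (legendre n)) x = 0}"
  note N = pderiv_legendre_roots[OF assms]
  have sq: "(poly (legendre n) (-1))\<^sup>2 = 1" "(poly (legendre n) 1)\<^sup>2 = 1"
    by (simp_all add: poly_legendre_pm_1_square)
  have disj: "{-1, 1} \<inter> ?N = {}"
    using N(3) by auto
  have "?N = {}" if "n = 1"
    using N(1,2) that by simp
  then show ?thesis
    using N(1) disj sq by (cases "n = 1") (auto simp: lobatto_def sum.union_disjoint mult_ac add_ac)
qed

text \<open>
  The node polynomial \<open>(x\<^sup>2 - 1) P'\<close> is orthogonal to all polynomials of degree below
  \<open>n - 1\<close>, by one integration by parts. The endpoint weights follow by applying the rule to
  \<open>(1 + e x) P'\<close>, which vanishes at all nodes except \<open>e\<close>. For an interior node \<open>t\<close>, the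
  computation with \<open>P\<close> in the Gauss case would exceed the degree of exactness, so it is done with
  \<open>v = P' / (x - t)\<close> and the extra factor \<open>b = 1 - x\<^sup>2\<close>, which removes the endpoints:
  \<open>2 b v P'' = b v\<^sup>2 + 2 x (x - t) v\<^sup>2 + (b (x - t) v\<^sup>2)'\<close>. The rule has the same value on
  \<open>b v P''\<close> and \<open>b v\<^sup>2\<close>, and on \<open>x (x - t) v\<^sup>2\<close> it sees the endpoints alone.
  Legendre's differential equation converts derivatives into values of \<open>P\<close>.
\<close>
lemma lobatto_exact:
  assumes "n \<ge> 1"
  shows "exact_on_degree (2 * n - 1) (lobatto (n + 1))"
proof -
  let ?P = "legendre n"
  let ?W = "x_square_minus_1 * pderiv ?P"
  define k where "k = real n * (real n + 1)"
  have k: "k > 0"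
    using assms by (simp add: k_def)
  define N where "N = {x. poly (pderiv ?P) x = 0}"
  define M where "M = {-1, 1} \<union> N"
  define w where "w = (\<lambda>t. poly_integral (lagrange_basis M t))"
  note N = pderiv_legendre_roots[OF assms, folded N_def]
  have P'0: "pderiv ?P \<noteq> 0"
    using assms by (simp add: pderiv_eq_0_iff)
  have "{-1, 1} \<inter> N = {}"
    using N(3) by auto
  then have M: "finite M" "card M = n + 1"
    using N(1,2) assms by (simp_all add: M_def card_Un_disjoint)
  have degW: "degree ?W = n + 1"
    using P'0 assms by (subst degree_mult_eq) (auto simp: degree_pderiv)
  have quad: "poly_integral p = (\<Sum>t\<in>M. w t * poly p t)" if "degree p \<le> 2 * n - 1" for p
    unfolding w_def
  proof (rule interpolatory_quadrature)
    show "poly_integral (?W * q) = 0" if "degree ?W + degree q \<le> 2 * n - 1" for q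
    proof -
      have "degree (pderiv (x_square_minus_1 * q)) < n"
        using that degree_mult_le[of x_square_minus_1 q] unfolding degW degree_pderiv by simp
      then have "poly_integral (?P * pderiv (x_square_minus_1 * q)) = 0"
        by (rule poly_integral_legendre_mult)
      then have "poly_integral (pderiv ?P * (x_square_minus_1 * q)) = 0"
        by (subst poly_integral_by_parts) simp
      then show ?thesis
        by (simp only: mult_ac)
    qed
    show "?W \<noteq> 0"
      using degW by auto
    show "poly ?W t = 0" if "t \<in> M" for t
      using that by (auto simp: M_def N_def)
  qed (use M degW that in simp_all)
  have derivative_at_end: "poly (pderiv ?P) e = e * k / 2 * poly ?P e" if "e\<^sup>2 = 1" for e
  proof -
    \<comment> \<open>the differential equation degenerates at the endpoints; \<open>e\<close> is its own inverse\<close>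
    have "e * (2 * e * poly (pderiv ?P) e) = e * (k * poly ?P e)"
      using poly_legendre_ode[of e n] that by (simp add: k_def)
    moreover have "e * (2 * e * poly (pderiv ?P) e) = 2 * e\<^sup>2 * poly (pderiv ?P) e"
      by (simp add: power2_eq_square)
    ultimately show ?thesis
      using that by simp
  qed
  have weight_end: "w e = 2 / k" if e: "e\<^sup>2 = 1" for e
  proof -
    have e': "e = 1 \<or> e = -1"
      using e power2_eq_1_iff by blast
    let ?p = "pderiv ?P * [:1, e:]"
    have "degree ?p \<le> 2 * n - 1"
      using degree_mult_le[of "pderiv ?P" "[:1, e:]"] assms e' by (auto simp: degree_pderiv)
    then have "poly_integral ?p = (\<Sum>t\<in>M. w t * poly ?p t)"
      by (rule quad)
    also have "\<dots> = w e * poly ?p e"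
      by (rule sum_eq_single) (use M e' in \<open>auto simp: M_def N_def\<close>)
    also have "\<dots> = w e * 2 * poly (pderiv ?P) e"
      using e by (simp add: power2_eq_square)
    also have "\<dots> = w e * e * k * poly ?P e"
      unfolding derivative_at_end[OF e] by simp
    finally have 1: "poly_integral ?p = w e * e * k * poly ?P e" .
    have "pderiv [:1, e:] = [:e:]"
      by (simp add: pderiv_pCons)
    moreover have "poly_integral (?P * [:e:]) = 0"
      using assms by (intro poly_integral_legendre_mult) simp
    ultimately have "poly_integral ?p = 2 * e * poly ?P e"
      using e' by (subst poly_integral_by_parts) auto
    with 1 have "e * poly ?P e * (w e * k) = e * poly ?P e * 2"
      by (simp add: mult_ac)
    moreover have "e * poly ?P e \<noteq> 0"
      using e' poly_legendre_pm_1[OF e, of n] by auto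
    ultimately have "w e * k = 2"
      by (metis mult_left_cancel)
    then show ?thesis
      using k by (simp add: field_simps)
  qed
  have weight_interior: "w t = 2 / (k * (poly ?P t)\<^sup>2)" if t: "t \<in> N" for t
  proof -
    obtain v where v: "pderiv ?P = [:- t, 1:] * v"
      using t unfolding N_def by (auto simp: poly_eq_0_iff_dvd dvd_def)
    have v0: "v \<noteq> 0"
      using v P'0 by auto
    have deg: "Suc (degree v) = n - 1"
      using degree_mult_eq[of "[:- t, 1:]" v] v0 unfolding v[symmetric] by (simp add: degree_pderiv)
    have tI: "-1 < t" "t < 1"
      using t N(3) by auto
    have d: "1 - t\<^sup>2 > 0"
      using tI by (simp add: abs_square_less_1)
    have dP: "pderiv (pderiv ?P) = v + [:- t, 1:] * pderiv v"
      unfolding v by (simp only: pderiv_mult) (simp add: pderiv_pCons)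
    have vN: "poly v x = 0" if "x \<in> N - {t}" for x
    proof -
      have "poly (pderiv ?P) x = 0" "x \<noteq> t"
        using that by (auto simp: N_def)
      then show ?thesis
        unfolding v by simp
    qed
    have vt: "poly (pderiv (pderiv ?P)) t = poly v t"
      unfolding dP by simp
    define J where "J = w t * (1 - t\<^sup>2) * (poly v t)\<^sup>2"
    let ?b = "[:1, 0, -1:] :: real poly"
    have J: "poly_integral (?b * (v * q)) = J" if "degree q \<le> degree v" "poly q t = poly v t" for q
    proof -
      have "degree (?b * (v * q)) \<le> 2 * n - 1"
        using deg that(1) degree_mult_le[of ?b "v * q"] degree_mult_le[of v q] by simp
      then have "poly_integral (?b * (v * q)) = (\<Sum>x\<in>M. w x * poly (?b * (v * q)) x)"
        by (rule quad)
      also have "\<dots> = w t * poly (?b * (v * q)) t"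
        by (rule sum_eq_single) (use M t vN in \<open>auto simp: M_def\<close>)
      finally show ?thesis
        using that(2) by (simp add: J_def power2_eq_square algebra_simps)
    qed
    have ends: "(poly v 1)\<^sup>2 * (1 - t)\<^sup>2 = (k / 2)\<^sup>2" "(poly v (-1))\<^sup>2 * (1 + t)\<^sup>2 = (k / 2)\<^sup>2"
    proof -
      have sq: "(poly (pderiv ?P) e)\<^sup>2 = (k / 2)\<^sup>2" if "e\<^sup>2 = 1" for e
        unfolding derivative_at_end[OF that]
        using that by (simp add: power_mult_distrib power_divide poly_legendre_pm_1_square)
      have "poly v 1 * (1 - t) = poly (pderiv ?P) 1"
        "poly v (-1) * (1 + t) = - poly (pderiv ?P) (-1)"
        unfolding v by (simp_all add: algebra_simps)
      then have "(poly v 1 * (1 - t))\<^sup>2 = (k / 2)\<^sup>2" "(poly v (-1) * (1 + t))\<^sup>2 = (k / 2)\<^sup>2"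
        using sq[of 1] sq[of "-1"] by simp_all
      then show "(poly v 1)\<^sup>2 * (1 - t)\<^sup>2 = (k / 2)\<^sup>2" "(poly v (-1))\<^sup>2 * (1 + t)\<^sup>2 = (k / 2)\<^sup>2"
        by (simp_all only: power_mult_distrib)
    qed
    let ?q = "[:0, 1:] * [:- t, 1:] * (v * v)"
    have Q: "poly_integral ?q = k / (1 - t\<^sup>2)"
    proof -
      have "degree ?q \<le> 2 * n - 1"
        using deg degree_mult_le[of "[:0, 1:] * [:- t, 1:]" "v * v"] degree_mult_le[of v v]
        by simp
      then have "poly_integral ?q = (\<Sum>x\<in>M. w x * poly ?q x)"
        by (rule quad)
      also have "\<dots> = (\<Sum>x\<in>{-1, 1}. w x * poly ?q x)"
      proof (rule sum.mono_neutral_right)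
        show "\<forall>x\<in>M - {-1, 1}. w x * poly ?q x = 0"
          using vN by (auto simp: M_def)
      qed (use M in \<open>auto simp: M_def\<close>)
      also have "\<dots> = 2 / k * ((1 - t) * (poly v 1)\<^sup>2 + (1 + t) * (poly v (-1))\<^sup>2)"
        by (simp add: weight_end power2_eq_square algebra_simps)
      also have "\<dots> = 2 / k * ((k / 2)\<^sup>2 / (1 - t) + (k / 2)\<^sup>2 / (1 + t))"
        using mult_eq_divide_of_square[OF ends(1)] mult_eq_divide_of_square[OF ends(2)] tI by simp
      also have "\<dots> = 2 / k * (k / 2)\<^sup>2 * (1 / (1 - t) + 1 / (1 + t))"
        by (simp add: distrib_left mult.assoc)
      also have "\<dots> = k / (1 - t\<^sup>2)"
        unfolding sum_reciprocals[OF tI] using k by (simp add: power2_eq_square)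
      finally show ?thesis .
    qed
    have "smult 2 (?b * (v * pderiv (pderiv ?P))) =
        ?b * (v * v) + smult 2 ?q + pderiv (?b * ([:- t, 1:] * (v * v)))"
      unfolding dP pderiv_mult by (rule poly_extensionality) (simp add: pderiv_pCons algebra_simps)
    from arg_cong[OF this, of poly_integral]
    have "2 * poly_integral (?b * (v * pderiv (pderiv ?P))) =
        poly_integral (?b * (v * v)) + 2 * poly_integral ?q"
      unfolding poly_integral_add poly_integral_smult poly_integral_pderiv by simp
    moreover have "poly_integral (?b * (v * pderiv (pderiv ?P))) = J"
      using deg by (intro J) (simp_all add: vt degree_pderiv)
    moreover have "poly_integral (?b * (v * v)) = J"
      by (intro J) simp_all
    ultimately have "J = 2 * k / (1 - t\<^sup>2)"
      using Q by simp
    then have W: "w t * ((1 - t\<^sup>2) * poly v t)\<^sup>2 = 2 * k"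
      using d by (simp add: J_def power2_eq_square field_simps)
    have "(t\<^sup>2 - 1) * poly v t = k * poly ?P t"
      using poly_legendre_ode[of t n] t by (simp add: vt N_def k_def)
    then have "((1 - t\<^sup>2) * poly v t)\<^sup>2 = (k * poly ?P t)\<^sup>2"
      by (metis minus_diff_eq mult_minus_left power2_minus)
    with W have W': "w t * (k * poly ?P t)\<^sup>2 = 2 * k"
      by simp
    then have "poly ?P t \<noteq> 0"
      using k by auto
    then show ?thesis
      using W' k by (simp add: power2_eq_square field_simps)
  qed
  have "w t = 2 / (k * (poly ?P t)\<^sup>2)" if "t \<in> M" for t
  proof (cases "t \<in> N")
    case False
    then have t: "t\<^sup>2 = 1"
      using that by (auto simp: M_def)
    then have "(poly ?P t)\<^sup>2 = 1"
      by (rule poly_legendre_pm_1_square)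
    then show ?thesis
      using weight_end[OF t] by simp
  qed (rule weight_interior)
  then have "lobatto (n + 1) g = (\<Sum>t\<in>M. w t * g t)" for g
    unfolding lobatto_eq_sum[OF assms] M_def[unfolded N_def, symmetric] k_def[symmetric]
    by (simp cong: sum.cong)
  then show ?thesis
    by (simp add: exact_on_degree_iff_poly_integral quad)
qed

section \<open>Comparison of the functional with the two rules\<close>

text \<open>
  The factor \<open>(x + 1) (x - 1)\<close> is nonpositive on the interval, which reverses the inequality
  for the Lobatto rule.
\<close>
theorem theorem14:
  fixes n :: nat
    and X :: "(real \<Rightarrow> real) set"
    and T :: "(real \<Rightarrow> real) \<Rightarrow> real"
    and f :: "real \<Rightarrow> real"
  assumes "n \<ge> 1"
    and "fun_space.subspace X"
    and "fun_space.span {g. m_convex_on (2 * n - 1) {-1..1} g} \<subseteq> X"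
    and "linear_functional_on X T"
    and "positive_functional_on {-1..1} X T"
    and "exact_on_degree (2 * n - 1) T"
    and "m_convex_on (2 * n - 1) {-1..1} f"
  shows "gauss_legendre n f \<le> T f \<and> T f \<le> lobatto (n + 1) f"
proof
  note definite = definite_quadrature[OF assms(2-7)]
  let ?G = "{x. poly (legendre n) x = 0}" and ?L = "{x. poly (pderiv (legendre n)) x = 0}"
  define u where "u = (\<lambda>t. 2 * (1 - t\<^sup>2) / ((real n + 1)\<^sup>2 * (poly (legendre (n + 1)) t)\<^sup>2))"
  define v where "v = (\<lambda>t. 2 / (real n * (real n + 1) * (poly (legendre n) t)\<^sup>2))"
  have G: "gauss_legendre n = (\<lambda>g. \<Sum>t\<in>{} \<union> ?G. u t * g t)"
    by (simp add: gauss_legendre_def u_def fun_eq_iff)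
  have "1 * (\<Sum>t\<in>{} \<union> ?G. u t * f t) \<le> 1 * T f"
    by (rule definite) (use legendre_roots[of n] assms(1) gauss_legendre_exact[of n] G in auto)
  then show "gauss_legendre n f \<le> T f"
    unfolding G by simp
  have L: "lobatto (n + 1) = (\<lambda>g. \<Sum>t\<in>{-1, 1} \<union> ?L. v t * g t)"
    unfolding v_def by (rule ext) (rule lobatto_eq_sum[OF assms(1)])
  have "-1 * (\<Sum>t\<in>{-1, 1} \<union> ?L. v t * f t) \<le> -1 * T f"
  proof (rule definite)
    show "0 \<le> -1 * (\<Prod>e\<in>{-1, 1}. x - e)" if "x \<in> {-1..1}" for x :: real
      using that by (simp add: mult_nonneg_nonpos)
    show "exact_on_degree (2 * n - 1) (\<lambda>g. \<Sum>t\<in>{-1, 1} \<union> ?L. v t * g t)"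
      using lobatto_exact[OF assms(1)] unfolding L .
  qed (use pderiv_legendre_roots[OF assms(1)] assms(1) in auto)
  then show "T f \<le> lobatto (n + 1) f"
    unfolding L by simp
qed

end
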